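(* Let $p$ be an odd prime and $q$ a prime with $q\equiv1\pmod p$. Let $G$ be the pro-$p$ group topologically generated by two elements $\sigma,\tau$ subject to the single relation $\sigma\tau\sigma^{-1}=\tau^q$. Then there exists a continuous homomorphism $\rho:G\to\mathrm{SL}_2^1(\mathbb{Z}_p)$ such that $\rho(\tau)$ has infinite order.
   Context: $\mathrm{SL}_2^1(\mathbb{Z}_p)$ is the kernel of the reduction map $\mathrm{SL}_2(\mathbb{Z}_p)\to\mathrm{SL}_2(\mathbb{F}_p)$. $G$ is the quotient of the free pro-$p$ group on $\sigma,\tau$ by the closed normal subgroup generated by $\sigma\tau\sigma^{-1}\tau^{-q}$. *)

theory Defs
  imports
    "HOL-Analysis.Analysis"
    "HOL-Number_Theory.Residues"
begin

section \<open>The ring of p-adic integers\<close>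

text \<open>
  The inverse limit of the rings \<open>\<int>/p\<^bsup>n+1\<^esup>\<close> for \<open>n \<ge> 0\<close>. The trivial quotient \<open>\<int>/p\<^sup>0\<close> is left out
  because the unit of \<^term>\<open>residue_ring 1\<close> lies outside its carrier. In particular, the component
  at index \<open>0\<close> is the residue modulo \<open>p\<close>.
\<close>

definition padic_ring :: "nat \<Rightarrow> (nat \<Rightarrow> int) ring" where
  "padic_ring p =
    \<lparr>carrier = {x. (\<forall>n. x n \<in> carrier (residue_ring (int p ^ Suc n))) \<and>
                    (\<forall>n. x (Suc n) mod int p ^ Suc n = x n)},
     monoid.mult = (\<lambda>x y n. x n \<otimes>\<^bsub>residue_ring (int p ^ Suc n)\<^esub> y n),
     one = (\<lambda>n. \<one>\<^bsub>residue_ring (int p ^ Suc n)\<^esub>),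
     ring.zero = (\<lambda>n. \<zero>\<^bsub>residue_ring (int p ^ Suc n)\<^esub>),
     ring.add = (\<lambda>x y n. x n \<oplus>\<^bsub>residue_ring (int p ^ Suc n)\<^esub> y n)\<rparr>"

definition padic_topology :: "nat \<Rightarrow> (nat \<Rightarrow> int) topology" where
  "padic_topology p =
    subtopology
      (product_topology (\<lambda>n. discrete_topology (carrier (residue_ring (int p ^ Suc n)))) UNIV)
      (carrier (padic_ring p))"

definition padic_reduction :: "(nat \<Rightarrow> int) \<Rightarrow> int" where
  "padic_reduction x = x 0"


section \<open>Special linear groups of degree two\<close>

text \<open>The quadruple \<open>(a, b, c, d)\<close> is the matrix with rows \<open>(a, b)\<close> and \<open>(c, d)\<close>.\<close>

type_synonym 'a mat2 = "'a \<times> 'a \<times> 'a \<times> 'a"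

fun mat2_mult :: "('a, 'm) ring_scheme \<Rightarrow> 'a mat2 \<Rightarrow> 'a mat2 \<Rightarrow> 'a mat2" where
  "mat2_mult R (a, b, c, d) (a', b', c', d') =
    (a \<otimes>\<^bsub>R\<^esub> a' \<oplus>\<^bsub>R\<^esub> b \<otimes>\<^bsub>R\<^esub> c', a \<otimes>\<^bsub>R\<^esub> b' \<oplus>\<^bsub>R\<^esub> b \<otimes>\<^bsub>R\<^esub> d',
     c \<otimes>\<^bsub>R\<^esub> a' \<oplus>\<^bsub>R\<^esub> d \<otimes>\<^bsub>R\<^esub> c', c \<otimes>\<^bsub>R\<^esub> b' \<oplus>\<^bsub>R\<^esub> d \<otimes>\<^bsub>R\<^esub> d')"

fun mat2_det :: "('a, 'm) ring_scheme \<Rightarrow> 'a mat2 \<Rightarrow> 'a" where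
  "mat2_det R (a, b, c, d) = a \<otimes>\<^bsub>R\<^esub> d \<ominus>\<^bsub>R\<^esub> b \<otimes>\<^bsub>R\<^esub> c"

fun mat2_map :: "('a \<Rightarrow> 'b) \<Rightarrow> 'a mat2 \<Rightarrow> 'b mat2" where
  "mat2_map f (a, b, c, d) = (f a, f b, f c, f d)"

definition SL2 :: "('a, 'm) ring_scheme \<Rightarrow> 'a mat2 monoid" where
  "SL2 R =
    \<lparr>carrier = {A \<in> carrier R \<times> carrier R \<times> carrier R \<times> carrier R. mat2_det R A = \<one>\<^bsub>R\<^esub>},
     monoid.mult = mat2_mult R,
     one = (\<one>\<^bsub>R\<^esub>, \<zero>\<^bsub>R\<^esub>, \<zero>\<^bsub>R\<^esub>, \<one>\<^bsub>R\<^esub>)\<rparr>"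

definition SL2_1_padic :: "nat \<Rightarrow> (nat \<Rightarrow> int) mat2 monoid" where
  "SL2_1_padic p =
    (SL2 (padic_ring p))
      \<lparr>carrier := kernel (SL2 (padic_ring p)) (SL2 (residue_ring (int p))) (mat2_map padic_reduction)\<rparr>"

definition SL2_1_padic_topology :: "nat \<Rightarrow> (nat \<Rightarrow> int) mat2 topology" where
  "SL2_1_padic_topology p =
    subtopology
      (prod_topology (padic_topology p) (prod_topology (padic_topology p)
        (prod_topology (padic_topology p) (padic_topology p))))
      (carrier (SL2_1_padic p))"


section \<open>The free group on a type of generators\<close>

text \<open>
  A letter \<open>(a, True)\<close> stands for the generator \<open>a\<close> and \<open>(a, False)\<close> for its inverse. Group elements
  are the classes of words modulo insertion and deletion of adjacent mutually inverse letters.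
\<close>

type_synonym 'a word = "('a \<times> bool) list"

inductive word_eq :: "'a word \<Rightarrow> 'a word \<Rightarrow> bool" where
  word_eq_cancel: "word_eq (u @ [(a, e), (a, \<not> e)] @ v) (u @ v)"
| word_eq_refl: "word_eq u u"
| word_eq_sym: "word_eq u v \<Longrightarrow> word_eq v u"
| word_eq_trans: "word_eq u v \<Longrightarrow> word_eq v w \<Longrightarrow> word_eq u w"

definition word_class :: "'a word \<Rightarrow> 'a word set" where
  "word_class u = {v. word_eq u v}"

definition free_group :: "'a word set monoid" where
  "free_group =
    \<lparr>carrier = range word_class,
     monoid.mult = (\<lambda>A B. \<Union>u\<in>A. \<Union>v\<in>B. word_class (u @ v)),
     one = word_class []\<rparr>"

definition free_gen :: "'a \<Rightarrow> 'a word set" where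
  "free_gen a = word_class [(a, True)]"


section \<open>Pro-p completion\<close>

definition p_power_index_normals :: "nat \<Rightarrow> ('a, 'm) monoid_scheme \<Rightarrow> 'a set set" where
  "p_power_index_normals p F = {N. N \<lhd> F \<and> (\<exists>k. order (F Mod N) = p ^ k)}"

text \<open>
  The inverse limit of the quotients \<open>F/N\<close> over the normal subgroups \<open>N\<close> of \<open>p\<close>-power index. For
  \<open>N \<subseteq> M\<close>, the projection \<open>F/N \<rightarrow> F/M\<close> sends a coset of \<open>N\<close> to the coset of \<open>M\<close> containing it, so
  that compatibility of a family \<open>x\<close> reads \<open>x N \<subseteq> x M\<close>.
\<close>

definition pro_p_completion ::
    "nat \<Rightarrow> ('a, 'm) monoid_scheme \<Rightarrow> ('a set \<Rightarrow> 'a set) monoid" where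
  "pro_p_completion p F =
    \<lparr>carrier = {x \<in> \<Pi>\<^sub>E N \<in> p_power_index_normals p F. carrier (F Mod N).
                 \<forall>N \<in> p_power_index_normals p F. \<forall>M \<in> p_power_index_normals p F.
                   N \<subseteq> M \<longrightarrow> x N \<subseteq> x M},
     monoid.mult = (\<lambda>x y. \<lambda>N \<in> p_power_index_normals p F. x N \<otimes>\<^bsub>F Mod N\<^esub> y N),
     one = (\<lambda>N \<in> p_power_index_normals p F. \<one>\<^bsub>F Mod N\<^esub>)\<rparr>"

definition pro_p_completion_topology ::
    "nat \<Rightarrow> ('a, 'm) monoid_scheme \<Rightarrow> ('a set \<Rightarrow> 'a set) topology" where
  "pro_p_completion_topology p F =
    subtopology
      (product_topology (\<lambda>N. discrete_topology (carrier (F Mod N))) (p_power_index_normals p F))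
      (carrier (pro_p_completion p F))"

definition pro_p_completion_map ::
    "nat \<Rightarrow> ('a, 'm) monoid_scheme \<Rightarrow> 'a \<Rightarrow> ('a set \<Rightarrow> 'a set)" where
  "pro_p_completion_map p F g = (\<lambda>N \<in> p_power_index_normals p F. N #>\<^bsub>F\<^esub> g)"


section \<open>Quotients of topological groups\<close>

definition closed_normal_closure ::
    "('a, 'm) monoid_scheme \<Rightarrow> 'a topology \<Rightarrow> 'a set \<Rightarrow> 'a set" where
  "closed_normal_closure G T S = \<Inter>{N. N \<lhd> G \<and> closedin T N \<and> S \<subseteq> N}"

definition FactGroup_topology ::
    "('a, 'm) monoid_scheme \<Rightarrow> 'a topology \<Rightarrow> 'a set \<Rightarrow> 'a set topology" where
  "FactGroup_topology G T N =
    topology (\<lambda>U. U \<subseteq> carrier (G Mod N) \<and> openin T {x \<in> topspace T. N #>\<^bsub>G\<^esub> x \<in> U})"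

lemma openin_FactGroup_topology:
  "openin (FactGroup_topology G T N) U \<longleftrightarrow>
    U \<subseteq> carrier (G Mod N) \<and> openin T {x \<in> topspace T. N #>\<^bsub>G\<^esub> x \<in> U}"
proof -
  have "istopology (\<lambda>U. U \<subseteq> carrier (G Mod N) \<and> openin T {x \<in> topspace T. N #>\<^bsub>G\<^esub> x \<in> U})"
    unfolding istopology_def
  proof (intro conjI allI impI)
    fix U V
    assume U: "U \<subseteq> carrier (G Mod N) \<and> openin T {x \<in> topspace T. N #>\<^bsub>G\<^esub> x \<in> U}"
      and V: "V \<subseteq> carrier (G Mod N) \<and> openin T {x \<in> topspace T. N #>\<^bsub>G\<^esub> x \<in> V}"
    have "{x \<in> topspace T. N #>\<^bsub>G\<^esub> x \<in> U \<inter> V} =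
        {x \<in> topspace T. N #>\<^bsub>G\<^esub> x \<in> U} \<inter> {x \<in> topspace T. N #>\<^bsub>G\<^esub> x \<in> V}"
      by blast
    then show "openin T {x \<in> topspace T. N #>\<^bsub>G\<^esub> x \<in> U \<inter> V}"
      using U V by (simp add: openin_Int)
    show "U \<inter> V \<subseteq> carrier (G Mod N)"
      using U by blast
  next
    fix K
    assume K: "\<forall>U\<in>K. U \<subseteq> carrier (G Mod N) \<and> openin T {x \<in> topspace T. N #>\<^bsub>G\<^esub> x \<in> U}"
    have "{x \<in> topspace T. N #>\<^bsub>G\<^esub> x \<in> \<Union>K} = (\<Union>U\<in>K. {x \<in> topspace T. N #>\<^bsub>G\<^esub> x \<in> U})"
      by blast
    then show "openin T {x \<in> topspace T. N #>\<^bsub>G\<^esub> x \<in> \<Union>K}"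
      using K by auto
    show "\<Union>K \<subseteq> carrier (G Mod N)"
      using K by blast
  qed
  then show ?thesis
    by (simp add: FactGroup_topology_def)
qed


section \<open>The pro-p group with one relation\<close>

datatype generator = gen_sigma | gen_tau

abbreviation free_pro_p :: "nat \<Rightarrow> (generator word set set \<Rightarrow> generator word set set) monoid" where
  "free_pro_p p \<equiv> pro_p_completion p free_group"

abbreviation free_pro_p_topology ::
    "nat \<Rightarrow> (generator word set set \<Rightarrow> generator word set set) topology" where
  "free_pro_p_topology p \<equiv> pro_p_completion_topology p free_group"

definition free_pro_p_gen ::
    "nat \<Rightarrow> generator \<Rightarrow> (generator word set set \<Rightarrow> generator word set set)" where
  "free_pro_p_gen p a = pro_p_completion_map p free_group (free_gen a)"

definition relator ::
    "nat \<Rightarrow> nat \<Rightarrow> (generator word set set \<Rightarrow> generator word set set)" where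
  "relator p q =
    free_pro_p_gen p gen_sigma \<otimes>\<^bsub>free_pro_p p\<^esub> free_pro_p_gen p gen_tau
      \<otimes>\<^bsub>free_pro_p p\<^esub> inv\<^bsub>free_pro_p p\<^esub> free_pro_p_gen p gen_sigma
      \<otimes>\<^bsub>free_pro_p p\<^esub> (free_pro_p_gen p gen_tau [^]\<^bsub>free_pro_p p\<^esub> (- int q))"

definition relation_subgroup ::
    "nat \<Rightarrow> nat \<Rightarrow> (generator word set set \<Rightarrow> generator word set set) set" where
  "relation_subgroup p q =
    closed_normal_closure (free_pro_p p) (free_pro_p_topology p) {relator p q}"

definition G_group ::
    "nat \<Rightarrow> nat \<Rightarrow> (generator word set set \<Rightarrow> generator word set set) set monoid" where
  "G_group p q = free_pro_p p Mod relation_subgroup p q"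

definition G_topology ::
    "nat \<Rightarrow> nat \<Rightarrow> (generator word set set \<Rightarrow> generator word set set) set topology" where
  "G_topology p q =
    FactGroup_topology (free_pro_p p) (free_pro_p_topology p) (relation_subgroup p q)"

definition G_gen ::
    "nat \<Rightarrow> nat \<Rightarrow> generator \<Rightarrow> (generator word set set \<Rightarrow> generator word set set) set" where
  "G_gen p q a = relation_subgroup p q #>\<^bsub>free_pro_p p\<^esub> free_pro_p_gen p a"

end

theory Submission
  imports Defs
begin

text \<open>
  As \<open>p\<close> is odd and \<open>q \<equiv> 1\<close> modulo \<open>p\<close>, the prime \<open>q\<close> has a square root \<open>s \<equiv> 1\<close> in the \<open>p\<close>-adic
  integers. Conjugation by \<open>diag(s, s\<^sup>-\<^sup>1)\<close> multiplies the upper right entry of a unipotent upper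
  triangular matrix by \<open>s\<^sup>2 = q\<close>, so \<open>\<sigma> \<mapsto> diag(s, s\<^sup>-\<^sup>1)\<close> and \<open>\<tau> \<mapsto> (1, p; 0, 1)\<close> respect the relation,
  and the image of \<open>\<tau>\<close> has infinite order. The assignment extends from the free group to its pro-\<open>p\<close>
  completion because \<open>SL\<^sub>2\<^sup>1\<close> modulo \<open>p\<^bsup>n+1\<^esup>\<close> has order \<open>p\<^bsup>3n\<^esup>\<close>, and it then factors through \<open>G\<close>
  because its kernel is closed.
\<close>

section \<open>The universal property of the free group\<close>

text \<open>The cancellation rule already allows a context on both sides, so it absorbs
  \<open>x\<close> and \<open>y\<close>; the other rules pass through the induction.\<close>

lemma word_eq_append_both: "word_eq u v \<Longrightarrow> word_eq (x @ u @ y) (x @ v @ y)"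
proof (induction rule: word_eq.induct)
  case (word_eq_cancel u a e v)
  show ?case
    using word_eq.word_eq_cancel[of "x @ u" a e "v @ y"] by simp
qed (blast intro: word_eq.intros)+

lemma word_eq_append: "word_eq u u' \<Longrightarrow> word_eq v v' \<Longrightarrow> word_eq (u @ v) (u' @ v')"
  using word_eq_append_both[of u u' "[]" v] word_eq_append_both[of v v' u' "[]"]
  by (auto intro: word_eq_trans)

lemma word_class_eq_iff: "word_class u = word_class v \<longleftrightarrow> word_eq u v"
  by (auto simp: word_class_def intro: word_eq_refl word_eq_sym word_eq_trans)

lemma self_in_word_class: "u \<in> word_class u"
  by (simp add: word_class_def word_eq_refl)

lemma carrier_free_group: "carrier free_group = range word_class"
  by (simp add: free_group_def)

lemma one_free_group: "\<one>\<^bsub>free_group\<^esub> = word_class []"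
  by (simp add: free_group_def)

text \<open>The double union in the product collapses to one class, since \<open>word_eq\<close> is
  a congruence for concatenation.\<close>

lemma mult_free_group:
  "word_class u \<otimes>\<^bsub>free_group\<^esub> word_class v = word_class (u @ v)"
proof -
  have "word_class (u' @ v') = word_class (u @ v)"
    if "u' \<in> word_class u" "v' \<in> word_class v" for u' v'
    unfolding word_class_eq_iff using that
    by (auto simp: word_class_def intro: word_eq_append word_eq_sym)
  then have "(\<Union>u'\<in>word_class u. \<Union>v'\<in>word_class v. word_class (u' @ v')) = word_class (u @ v)"
    using self_in_word_class by blast
  then show ?thesis
    by (simp add: free_group_def)
qed

definition word_inv :: "'a word \<Rightarrow> 'a word" where
  "word_inv w = rev (map (\<lambda>(a, e). (a, \<not> e)) w)"

lemma word_inv_append_self: "word_eq (word_inv w @ w) []"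
proof (induction w)
  case Nil
  then show ?case
    by (simp add: word_inv_def word_eq_refl)
next
  case (Cons l w)
  obtain a e where l: "l = (a, e)"
    by force
  \<comment> \<open>The double negation brings the inner pair into the shape of the cancellation
    rule.\<close>
  have "word_eq (word_inv w @ [(a, \<not> e), (a, \<not> \<not> e)] @ w) (word_inv w @ w)"
    by (rule word_eq_cancel)
  with Cons show ?case
    by (auto simp: l word_inv_def intro: word_eq_trans)
qed

lemma group_free_group: "group free_group"
proof (rule groupI)
  fix x :: "'a word set"
  assume "x \<in> carrier free_group"
  then obtain w where "x = word_class w"
    by (auto simp: carrier_free_group)
  then have "word_class (word_inv w) \<otimes>\<^bsub>free_group\<^esub> x = \<one>\<^bsub>free_group\<^esub>"
    by (simp add: mult_free_group one_free_group word_class_eq_iff word_inv_append_self)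
  then show "\<exists>y\<in>carrier free_group. y \<otimes>\<^bsub>free_group\<^esub> x = \<one>\<^bsub>free_group\<^esub>"
    by (auto simp: carrier_free_group)
qed (auto simp: carrier_free_group one_free_group mult_free_group)

section \<open>Evaluation of words in a group\<close>

fun eval_word :: "('b, 'm) monoid_scheme \<Rightarrow> ('a \<Rightarrow> 'b) \<Rightarrow> 'a word \<Rightarrow> 'b" where
  "eval_word H f [] = \<one>\<^bsub>H\<^esub>"
| "eval_word H f ((a, e) # w) = (if e then f a else inv\<^bsub>H\<^esub> f a) \<otimes>\<^bsub>H\<^esub> eval_word H f w"

lemma (in group) eval_word_closed:
  assumes "\<And>a. f a \<in> carrier G"
  shows "eval_word G f w \<in> carrier G"
  by (induction w) (use assms in auto)

lemma (in group) eval_word_append: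
  assumes "\<And>a. f a \<in> carrier G"
  shows "eval_word G f (u @ v) = eval_word G f u \<otimes> eval_word G f v"
  by (induction u) (use assms in \<open>auto simp: eval_word_closed m_assoc\<close>)

lemma (in group) eval_word_cong:
  assumes "\<And>a. f a \<in> carrier G" and "word_eq u v"
  shows "eval_word G f u = eval_word G f v"
  using assms(2)
proof induction
  case (word_eq_cancel u a e v)
  have "eval_word G f ([(a, e), (a, \<not> e)] @ v) = eval_word G f v"
    using assms(1) by (auto simp: eval_word_closed simp flip: m_assoc)
  then show ?case
    by (simp add: eval_word_append[OF assms(1)] del: append_Cons)
qed auto

lemma (in group) free_group_lift:
  assumes "\<And>a. f a \<in> carrier G"
  obtains \<phi> where "\<phi> \<in> hom free_group G" and "\<And>a. \<phi> (free_gen a) = f a"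
proof -
  \<comment> \<open>The representative is arbitrary; \<open>eval_word_cong\<close> makes the value
    independent of it.\<close>
  define \<phi> where "\<phi> A = eval_word G f (SOME w. w \<in> A)" for A
  have \<phi>: "\<phi> (word_class w) = eval_word G f w" for w
  proof -
    have "(SOME v. v \<in> word_class w) \<in> word_class w"
      by (rule someI, rule self_in_word_class)
    then show ?thesis
      unfolding \<phi>_def by (metis assms eval_word_cong mem_Collect_eq word_class_def)
  qed
  show ?thesis
  proof
    show "\<phi> \<in> hom free_group G"
      by (rule homI)
        (auto simp: carrier_free_group \<phi> mult_free_group assms eval_word_closed eval_word_append)
    show "\<phi> (free_gen a) = f a" for a
      using assms by (simp add: free_gen_def \<phi>)
  qed
qed

section \<open>The universal property of the pro-p completion\<close>

lemma p_power_index_normalsD: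
  "N \<in> p_power_index_normals p F \<Longrightarrow> N \<lhd> F"
  by (simp add: p_power_index_normals_def)

text \<open>By the first isomorphism theorem the index of the kernel is the order of the image. This
  divides \<open>p ^ k\<close> by Lagrange, so it is itself a power of the prime
  \<open>p\<close>.\<close>

lemma (in group_hom) kernel_in_p_power_index_normals:
  assumes "prime p" and "order H = p ^ k"
  shows "kernel G H h \<in> p_power_index_normals p G"
proof -
  \<comment> \<open>\<open>FactGroup_iso_set\<close> asks for a surjective map, so the codomain is
    cut down to the image.\<close>
  let ?I = "H\<lparr>carrier := h ` carrier G\<rparr>"
  have I: "subgroup (h ` carrier G) H"
    by (rule img_is_subgroup)
  then have "group_hom G ?I h"
    by (auto simp: group_hom_def group_hom_axioms_def hom_def H.subgroup_imp_group)
  then have "(\<lambda>X. the_elem (h ` X)) \<in> iso (G Mod kernel G ?I h) ?I"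
    by (rule group_hom.FactGroup_iso_set) simp
  moreover have "kernel G ?I h = kernel G H h"
    by (simp add: kernel_def)
  ultimately have "order (G Mod kernel G H h) = card (h ` carrier G)"
    using iso_same_order by (fastforce simp: order_def)
  moreover have "card (h ` carrier G) dvd p ^ k"
    using H.lagrange[OF I] assms by (metis dvd_triv_right)
  ultimately show ?thesis
    using assms(1) normal_kernel by (auto simp: p_power_index_normals_def divides_primepow_nat)
qed

lemma carrier_pro_p_completion_memD:
  assumes "x \<in> carrier (pro_p_completion p F)" and "N \<in> p_power_index_normals p F"
  shows "x N \<in> carrier (F Mod N)"
  using assms by (auto simp: pro_p_completion_def)

lemma pro_p_completion_eqI:
  assumes "x \<in> carrier (pro_p_completion p F)" and "y \<in> carrier (pro_p_completion p F)"
    and "\<And>N. N \<in> p_power_index_normals p F \<Longrightarrow> x N = y N"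
  shows "x = y"
  using assms by (intro PiE_ext[where k = "p_power_index_normals p F"]) (auto simp: pro_p_completion_def)

lemma mult_pro_p_completion_apply:
  "N \<in> p_power_index_normals p F \<Longrightarrow>
    (x \<otimes>\<^bsub>pro_p_completion p F\<^esub> y) N = x N \<otimes>\<^bsub>F Mod N\<^esub> y N"
  by (simp add: pro_p_completion_def)

lemma one_pro_p_completion_apply:
  "N \<in> p_power_index_normals p F \<Longrightarrow> \<one>\<^bsub>pro_p_completion p F\<^esub> N = \<one>\<^bsub>F Mod N\<^esub>"
  by (simp add: pro_p_completion_def)

lemma group_pro_p_completion:
  fixes F (structure)
  assumes "group F"
  shows "group (pro_p_completion p F)"
proof -
  interpret F: group F by fact
  let ?C = "pro_p_completion p F" and ?P = "p_power_index_normals p F"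
  have grp: "group (F Mod N)" if "N \<in> ?P" for N
    using that by (simp add: normal.factorgroup_is_group p_power_index_normalsD)
  have carrierI: "x \<in> carrier ?C"
    if "x \<in> extensional ?P" "\<And>N. N \<in> ?P \<Longrightarrow> x N \<in> carrier (F Mod N)"
      "\<And>N M. \<lbrakk>N \<in> ?P; M \<in> ?P; N \<subseteq> M\<rbrakk> \<Longrightarrow> x N \<subseteq> x M" for x
    using that by (auto simp: pro_p_completion_def PiE_def)
  have compat: "x N \<subseteq> x M" if "x \<in> carrier ?C" "N \<in> ?P" "M \<in> ?P" "N \<subseteq> M" for x N M
    using that by (auto simp: pro_p_completion_def)
  have m_closed: "x \<otimes>\<^bsub>?C\<^esub> y \<in> carrier ?C" if x: "x \<in> carrier ?C" and y: "y \<in> carrier ?C" for x y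
  proof (rule carrierI)
    show "x \<otimes>\<^bsub>?C\<^esub> y \<in> extensional ?P"
      by (simp add: pro_p_completion_def)
    show "(x \<otimes>\<^bsub>?C\<^esub> y) N \<in> carrier (F Mod N)" if "N \<in> ?P" for N
      using group.axioms(1)[OF grp[OF that]] monoid.m_closed carrier_pro_p_completion_memD[OF _ that] x y
      by (fastforce simp: mult_pro_p_completion_apply that simp del: mult_FactGroup)
    show "(x \<otimes>\<^bsub>?C\<^esub> y) N \<subseteq> (x \<otimes>\<^bsub>?C\<^esub> y) M" if "N \<in> ?P" "M \<in> ?P" "N \<subseteq> M" for N M
      \<comment> \<open>The product of cosets is a product of sets, hence monotone in both
        factors.\<close>
      using mono_set_mult[OF compat[OF x that] compat[OF y that]]
      by (simp add: mult_pro_p_completion_apply that)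
  qed
  have one_closed: "\<one>\<^bsub>?C\<^esub> \<in> carrier ?C"
  proof (rule carrierI)
    show "\<one>\<^bsub>?C\<^esub> \<in> extensional ?P"
      by (simp add: pro_p_completion_def)
    show "\<one>\<^bsub>?C\<^esub> N \<in> carrier (F Mod N)" if "N \<in> ?P" for N
      using group.axioms(1)[OF grp[OF that]] monoid.one_closed
      by (fastforce simp: one_pro_p_completion_apply that simp del: one_FactGroup)
  qed (simp add: one_pro_p_completion_apply)
  show ?thesis
  proof (rule groupI)
    fix x y z
    assume xyz: "x \<in> carrier ?C" "y \<in> carrier ?C" "z \<in> carrier ?C"
    show "x \<otimes>\<^bsub>?C\<^esub> y \<otimes>\<^bsub>?C\<^esub> z = x \<otimes>\<^bsub>?C\<^esub> (y \<otimes>\<^bsub>?C\<^esub> z)"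
    proof (rule pro_p_completion_eqI[of _ p F])
      fix N assume N: "N \<in> ?P"
      interpret Q: group "F Mod N"
        by (rule grp[OF N])
      show "(x \<otimes>\<^bsub>?C\<^esub> y \<otimes>\<^bsub>?C\<^esub> z) N = (x \<otimes>\<^bsub>?C\<^esub> (y \<otimes>\<^bsub>?C\<^esub> z)) N"
        using xyz[THEN carrier_pro_p_completion_memD, OF N] Q.m_assoc
        by (simp add: mult_pro_p_completion_apply N del: mult_FactGroup)
    qed (use xyz m_closed in auto)
  next
    fix x
    assume x: "x \<in> carrier ?C"
    show "\<one>\<^bsub>?C\<^esub> \<otimes>\<^bsub>?C\<^esub> x = x"
    proof (rule pro_p_completion_eqI[of _ p F])
      fix N assume N: "N \<in> ?P"
      interpret Q: group "F Mod N"
        by (rule grp[OF N])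
      show "(\<one>\<^bsub>?C\<^esub> \<otimes>\<^bsub>?C\<^esub> x) N = x N"
        using carrier_pro_p_completion_memD[OF x N] Q.l_one
        by (simp add: mult_pro_p_completion_apply one_pro_p_completion_apply N
            del: mult_FactGroup one_FactGroup)
    qed (use x m_closed one_closed in auto)
    define y where "y = (\<lambda>N\<in>?P. inv\<^bsub>F Mod N\<^esub> x N)"
    have y: "y \<in> carrier ?C"
    proof (rule carrierI)
      show "y \<in> extensional ?P"
        by (simp add: y_def)
      show "y N \<in> carrier (F Mod N)" if "N \<in> ?P" for N
        using group.inv_closed[OF grp[OF that] carrier_pro_p_completion_memD[OF x that]]
        by (simp add: y_def that)
      show "y N \<subseteq> y M" if "N \<in> ?P" "M \<in> ?P" "N \<subseteq> M" for N M
        \<comment> \<open>The inverse of a coset in the quotient is the set of inverses of its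
          elements, so inversion preserves inclusions.\<close>
        using normal.inv_FactGroup[OF p_power_index_normalsD carrier_pro_p_completion_memD[OF x]]
          compat[OF x that] that
        by (auto simp: y_def SET_INV_def)
    qed
    have "y \<otimes>\<^bsub>?C\<^esub> x = \<one>\<^bsub>?C\<^esub>"
    proof (rule pro_p_completion_eqI[of _ p F])
      fix N assume N: "N \<in> ?P"
      interpret Q: group "F Mod N"
        by (rule grp[OF N])
      show "(y \<otimes>\<^bsub>?C\<^esub> x) N = \<one>\<^bsub>?C\<^esub> N"
        using carrier_pro_p_completion_memD[OF x N] Q.l_inv
        by (simp add: mult_pro_p_completion_apply one_pro_p_completion_apply N y_def
            del: mult_FactGroup one_FactGroup)
    qed (use x y m_closed one_closed in auto)
    with y show "\<exists>y\<in>carrier ?C. y \<otimes>\<^bsub>?C\<^esub> x = \<one>\<^bsub>?C\<^esub>"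
      by blast
  qed (use m_closed one_closed in auto)
qed

lemma pro_p_completion_map_closed:
  assumes "g \<in> carrier F"
  shows "pro_p_completion_map p F g \<in> carrier (pro_p_completion p F)"
  using assms by (auto simp: pro_p_completion_map_def pro_p_completion_def carrier_FactGroup r_coset_def)

text \<open>For a homomorphism \<open>h\<close> whose kernel has p-power index, the component of
  \<open>x\<close> at this kernel is a coset on which \<open>h\<close> is constant;
  \<open>the_elem\<close> extracts the single value.\<close>

definition pro_p_lift ::
    "('a, 'm) monoid_scheme \<Rightarrow> ('b, 'n) monoid_scheme \<Rightarrow> ('a \<Rightarrow> 'b) \<Rightarrow> ('a set \<Rightarrow> 'a set) \<Rightarrow> 'b" where
  "pro_p_lift F H h x = the_elem (h ` x (kernel F H h))"

context group_hom
begin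

lemma image_kernel_coset:
  assumes "X \<in> carrier (G Mod kernel G H h)" and "g \<in> X"
  shows "the_elem (h ` X) = h g"
proof -
  obtain a where "a \<in> carrier G" "X = kernel G H h #> a"
    using assms by (auto simp: carrier_FactGroup)
  then have "\<forall>x\<in>X. h x = h a"
    by (force simp: kernel_def r_coset_def)
  with assms(2) show ?thesis
    by (metis empty_iff the_elem_image_unique)
qed

lemma pro_p_lift_eq:
  assumes "kernel G H h \<in> p_power_index_normals p G" and "x \<in> carrier (pro_p_completion p G)"
    and "g \<in> x (kernel G H h)"
  shows "pro_p_lift G H h x = h g"
  unfolding pro_p_lift_def
  using assms by (intro image_kernel_coset) (auto dest: carrier_pro_p_completion_memD)

lemma pro_p_lift_hom:
  assumes "kernel G H h \<in> p_power_index_normals p G"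
  shows "pro_p_lift G H h \<in> hom (pro_p_completion p G) H"
  unfolding pro_p_lift_def
  using FactGroup_hom assms
  by (auto simp: hom_def Pi_iff mult_pro_p_completion_apply carrier_pro_p_completion_memD)

lemma pro_p_lift_map:
  assumes "kernel G H h \<in> p_power_index_normals p G" and g: "g \<in> carrier G"
  shows "pro_p_lift G H h (pro_p_completion_map p G g) = h g"
proof (rule pro_p_lift_eq[where p = p])
  show "g \<in> pro_p_completion_map p G g (kernel G H h)"
    using assms G.rcos_self[OF g subgroup_kernel] by (simp add: pro_p_completion_map_def)
qed (use assms in \<open>auto simp: pro_p_completion_map_closed\<close>)

text \<open>The lift factors through the projection to one discrete quotient, and any map between
  discrete spaces is continuous.\<close>

lemma continuous_map_pro_p_lift:
  assumes N: "kernel G H h \<in> p_power_index_normals p G"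
  shows "continuous_map (pro_p_completion_topology p G) (discrete_topology (carrier H)) (pro_p_lift G H h)"
proof -
  let ?N = "kernel G H h"
  have "continuous_map (pro_p_completion_topology p G) (discrete_topology (carrier (G Mod ?N))) (\<lambda>x. x ?N)"
    unfolding pro_p_completion_topology_def
    by (intro continuous_map_from_subtopology continuous_map_product_projection N)
  moreover have "continuous_map (discrete_topology (carrier (G Mod ?N))) (discrete_topology (carrier H))
      (\<lambda>X. the_elem (h ` X))"
    using FactGroup_the_elem_mem by auto
  ultimately show ?thesis
    unfolding pro_p_lift_def[abs_def] by (rule continuous_map_compose[unfolded o_def])
qed

end

text \<open>Since \<open>f\<close> carries \<open>h'\<close> to \<open>h\<close>, the kernel of
  \<open>h'\<close> lies in that of \<open>h\<close>, and compatibility of \<open>x\<close> puts its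
  coset at the smaller kernel inside its coset at the larger one. A representative of the former
  computes both lifts.\<close>

lemma pro_p_lift_compat:
  assumes h: "group_hom F H h" and h': "group_hom F H' h'"
    and N: "kernel F H h \<in> p_power_index_normals p F"
    and N': "kernel F H' h' \<in> p_power_index_normals p F"
    and f: "group_hom H' H f" "\<And>g. g \<in> carrier F \<Longrightarrow> f (h' g) = h g"
    and x: "x \<in> carrier (pro_p_completion p F)"
  shows "f (pro_p_lift F H' h' x) = pro_p_lift F H h x"
proof -
  interpret h: group_hom F H h by fact
  interpret h': group_hom F H' h' by fact
  interpret f: group_hom H' H f by fact
  have "kernel F H' h' \<subseteq> kernel F H h"
    using f by (auto simp: kernel_def) (metis f.hom_one)
  then have sub: "x (kernel F H' h') \<subseteq> x (kernel F H h)"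
    using x N N' by (auto simp: pro_p_completion_def)
  have mem: "x (kernel F H' h') \<in> carrier (F Mod kernel F H' h')"
    using carrier_pro_p_completion_memD[OF x N'] .
  then obtain g where g: "g \<in> x (kernel F H' h')"
    using h'.FactGroup_nonempty by blast
  moreover have "g \<in> carrier F"
    using g mem by (auto simp: carrier_FactGroup r_coset_def kernel_def)
  ultimately show ?thesis
    using h.pro_p_lift_eq[OF N x] h'.pro_p_lift_eq[OF N' x] sub f(2) by auto
qed

section \<open>Quotients\<close>

lemma (in group) normal_Inter:
  assumes "A \<noteq> {}" and "\<And>N. N \<in> A \<Longrightarrow> N \<lhd> G"
  shows "\<Inter>A \<lhd> G"
  using assms subgroups_Inter[of A] unfolding normal_inv_iff by blast

text \<open>A set in the factor group is open when its preimage in \<open>G\<close> is, and the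
  preimage of the set where \<open>g\<close> lands in \<open>V\<close> is the set where
  \<open>h\<close> lands in \<open>V\<close>.\<close>

lemma (in group_hom) FactGroup_topology_universal:
  assumes cont: "continuous_map T U h" and "topspace T = carrier G"
    and N: "N \<lhd> G" "N \<subseteq> kernel G H h"
  obtains g where "g \<in> hom (G Mod N) H" and "continuous_map (FactGroup_topology G T N) U g"
    and "\<And>x. x \<in> carrier G \<Longrightarrow> g (N #> x) = h x"
proof -
  obtain g where g: "g \<in> hom (G Mod N) H" "\<And>x. x \<in> carrier G \<Longrightarrow> g (N #> x) = h x"
    using FactGroup_universal_kernel[OF N] by blast
  let ?Q = "FactGroup_topology G T N"
  have mod: "N #> x \<in> carrier (G Mod N)" if "x \<in> carrier G" for x
    using that by (auto simp: carrier_FactGroup)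
  \<comment> \<open>The underlying space has to be recovered from the open sets: the whole factor
    group is open because its preimage is all of \<open>topspace T\<close>.\<close>
  have Q: "topspace ?Q = carrier (G Mod N)"
  proof
    show "topspace ?Q \<subseteq> carrier (G Mod N)"
      using openin_topspace[of ?Q] by (simp only: openin_FactGroup_topology)
    have "{x \<in> topspace T. N #> x \<in> carrier (G Mod N)} = topspace T"
      using assms(2) mod by auto
    then have "openin ?Q (carrier (G Mod N))"
      by (simp add: openin_FactGroup_topology)
    then show "carrier (G Mod N) \<subseteq> topspace ?Q"
      by (rule openin_subset)
  qed
  have "continuous_map ?Q U g"
    unfolding continuous_map_def Q
  proof (intro conjI allI impI)
    show "g \<in> carrier (G Mod N) \<rightarrow> topspace U"
      using cont assms(2) by (force simp: carrier_FactGroup g(2) continuous_map_def)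
    fix V assume "openin U V"
    then have "openin T {x \<in> topspace T. h x \<in> V}"
      using cont by (simp add: continuous_map_def)
    moreover have "{x \<in> topspace T. N #> x \<in> {X \<in> carrier (G Mod N). g X \<in> V}} = {x \<in> topspace T. h x \<in> V}"
      using assms(2) mod g(2) by auto
    ultimately show "openin ?Q {X \<in> carrier (G Mod N). g X \<in> V}"
      by (simp add: openin_FactGroup_topology)
  qed
  with g show ?thesis
    using that by blast
qed

section \<open>Special linear groups and congruence subgroups\<close>

lemma mult_SL2: "monoid.mult (SL2 R) = mat2_mult R"
  by (simp add: SL2_def)

lemma one_SL2: "\<one>\<^bsub>SL2 R\<^esub> = (\<one>\<^bsub>R\<^esub>, \<zero>\<^bsub>R\<^esub>, \<zero>\<^bsub>R\<^esub>, \<one>\<^bsub>R\<^esub>)"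
  by (simp add: SL2_def)

lemma mem_SL2_iff:
  "(a, b, c, d) \<in> carrier (SL2 R) \<longleftrightarrow>
    a \<in> carrier R \<and> b \<in> carrier R \<and> c \<in> carrier R \<and> d \<in> carrier R \<and>
    a \<otimes>\<^bsub>R\<^esub> d \<ominus>\<^bsub>R\<^esub> b \<otimes>\<^bsub>R\<^esub> c = \<one>\<^bsub>R\<^esub>"
  by (simp add: SL2_def)

text \<open>Multiplicativity of the determinant, expanded into entries so that it rewrites the
  closure goal for \<open>SL2 R\<close> once matrices are split into tuples.\<close>

lemma (in cring) mat2_det_mult:
  assumes "a \<in> carrier R" "b \<in> carrier R" "c \<in> carrier R" "d \<in> carrier R"
    and "a' \<in> carrier R" "b' \<in> carrier R" "c' \<in> carrier R" "d' \<in> carrier R"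
  shows "(a \<otimes> a' \<oplus> b \<otimes> c') \<otimes> (c \<otimes> b' \<oplus> d \<otimes> d') \<ominus> (a \<otimes> b' \<oplus> b \<otimes> d') \<otimes> (c \<otimes> a' \<oplus> d \<otimes> c') =
    (a \<otimes> d \<ominus> b \<otimes> c) \<otimes> (a' \<otimes> d' \<ominus> b' \<otimes> c')"
  using assms by algebra

lemma (in cring) group_SL2: "group (SL2 R)"
proof (rule groupI)
  fix x y assume "x \<in> carrier (SL2 R)" "y \<in> carrier (SL2 R)"
  then show "x \<otimes>\<^bsub>SL2 R\<^esub> y \<in> carrier (SL2 R)"
    by (cases x; cases y) (simp add: mem_SL2_iff mult_SL2 mat2_det_mult)
next
  show "\<one>\<^bsub>SL2 R\<^esub> \<in> carrier (SL2 R)"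
    by (simp add: one_SL2 mem_SL2_iff minus_eq)
next
  fix x y z assume "x \<in> carrier (SL2 R)" "y \<in> carrier (SL2 R)" "z \<in> carrier (SL2 R)"
  then show "x \<otimes>\<^bsub>SL2 R\<^esub> y \<otimes>\<^bsub>SL2 R\<^esub> z = x \<otimes>\<^bsub>SL2 R\<^esub> (y \<otimes>\<^bsub>SL2 R\<^esub> z)"
    by (cases x; cases y; cases z)
      (simp add: mem_SL2_iff mult_SL2 l_distr r_distr m_assoc a_ac)
next
  fix x assume "x \<in> carrier (SL2 R)"
  then show "\<one>\<^bsub>SL2 R\<^esub> \<otimes>\<^bsub>SL2 R\<^esub> x = x"
    by (cases x) (simp add: mem_SL2_iff mult_SL2 one_SL2)
next
  fix x assume x: "x \<in> carrier (SL2 R)"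
  obtain a b c d where abcd: "x = (a, b, c, d)"
    by (cases x)
  have R: "a \<in> carrier R" "b \<in> carrier R" "c \<in> carrier R" "d \<in> carrier R"
    and det: "a \<otimes> d \<ominus> b \<otimes> c = \<one>"
    using x by (auto simp: abcd mem_SL2_iff)
  \<comment> \<open>The inverse is the adjugate \<open>(d, \<ominus> b, \<ominus> c, a)\<close>. The
    first identity gives its determinant, the other four the entries of its product with
    \<open>x\<close>.\<close>
  have 1: "d \<otimes> a \<ominus> (\<ominus> b) \<otimes> (\<ominus> c) = a \<otimes> d \<ominus> b \<otimes> c"
    using R by algebra
  have 2: "d \<otimes> a \<oplus> \<ominus> b \<otimes> c = a \<otimes> d \<ominus> b \<otimes> c"
    using R by algebra
  have 3: "d \<otimes> b \<oplus> \<ominus> b \<otimes> d = \<zero>"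
    using R by algebra
  have 4: "\<ominus> c \<otimes> a \<oplus> a \<otimes> c = \<zero>"
    using R by algebra
  have 5: "\<ominus> c \<otimes> b \<oplus> a \<otimes> d = a \<otimes> d \<ominus> b \<otimes> c"
    using R by algebra
  have "(d, \<ominus> b, \<ominus> c, a) \<in> carrier (SL2 R)"
    using R det by (simp add: mem_SL2_iff 1)
  moreover have "(d, \<ominus> b, \<ominus> c, a) \<otimes>\<^bsub>SL2 R\<^esub> x = \<one>\<^bsub>SL2 R\<^esub>"
    by (simp add: abcd mult_SL2 one_SL2 2 3 4 5 det)
  ultimately show "\<exists>y\<in>carrier (SL2 R). y \<otimes>\<^bsub>SL2 R\<^esub> x = \<one>\<^bsub>SL2 R\<^esub>"
    by blast
qed

lemma SL2_hom:
  assumes "cring R" and "cring S" and "f \<in> ring_hom R S"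
  shows "group_hom (SL2 R) (SL2 S) (mat2_map f)"
proof -
  interpret f: ring_hom_cring R S f
    using assms by (simp add: ring_hom_cring_def ring_hom_cring_axioms_def)
  have "mat2_map f \<in> hom (SL2 R) (SL2 S)"
  proof (rule homI)
    fix x assume x: "x \<in> carrier (SL2 R)"
    obtain a b c d where abcd: "x = (a, b, c, d)"
      by (cases x)
    have R: "a \<in> carrier R" "b \<in> carrier R" "c \<in> carrier R" "d \<in> carrier R"
      and det: "a \<otimes>\<^bsub>R\<^esub> d \<ominus>\<^bsub>R\<^esub> b \<otimes>\<^bsub>R\<^esub> c = \<one>\<^bsub>R\<^esub>"
      using x by (auto simp: abcd mem_SL2_iff)
    have "f a \<otimes>\<^bsub>S\<^esub> f d \<ominus>\<^bsub>S\<^esub> f b \<otimes>\<^bsub>S\<^esub> f c = f (a \<otimes>\<^bsub>R\<^esub> d \<ominus>\<^bsub>R\<^esub> b \<otimes>\<^bsub>R\<^esub> c)"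
      using R by (simp add: a_minus_def)
    with R show "mat2_map f x \<in> carrier (SL2 S)"
      by (simp add: abcd mem_SL2_iff det)
  next
    fix x y assume "x \<in> carrier (SL2 R)" "y \<in> carrier (SL2 R)"
    then show "mat2_map f (x \<otimes>\<^bsub>SL2 R\<^esub> y) = mat2_map f x \<otimes>\<^bsub>SL2 S\<^esub> mat2_map f y"
      by (cases x; cases y) (simp add: mem_SL2_iff mult_SL2)
  qed
  then show ?thesis
    by (simp add: group_hom_def group_hom_axioms_def cring.group_SL2 assms)
qed

section \<open>Congruence subgroups over the residue rings\<close>

lemma cring_residue_ring: "m > 1 \<Longrightarrow> cring (residue_ring m)"
  using residues.cring residues.intro by blast

lemma residue_ring_reduction:
  assumes "k dvd m" and "k > 1" and "m > 1"
  shows "(\<lambda>x. x mod k) \<in> ring_hom (residue_ring m) (residue_ring k)"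
  using assms
  by (intro ring_hom_memI) (auto simp: residue_ring_def mod_mod_cancel mod_simps)

text \<open>For prime \<open>p\<close> these are the finite levels of \<open>SL2_1_padic\<close>.
  Restricting to the kernel modulo \<open>p\<close> makes the order a power of \<open>p\<close>;
  with the index shift, level 0 is the trivial group.\<close>

definition SL2_congruence :: "nat \<Rightarrow> nat \<Rightarrow> int mat2 monoid" where
  "SL2_congruence p n =
    (SL2 (residue_ring (int p ^ Suc n)))
      \<lparr>carrier := kernel (SL2 (residue_ring (int p ^ Suc n))) (SL2 (residue_ring (int p)))
        (mat2_map (\<lambda>x. x mod int p))\<rparr>"

context
  fixes p :: nat
  assumes p: "prime p"
begin

lemma prime_power_gt_1: "int p ^ Suc n > 1"
  using p prime_gt_1_nat[of p] one_less_power[of "int p" "Suc n"] by simp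

lemma group_SL2_congruence: "group (SL2_congruence p n)"
proof -
  have "(\<lambda>x. x mod int p) \<in> ring_hom (residue_ring (int p ^ Suc n)) (residue_ring (int p))"
    using prime_power_gt_1[of 0] prime_power_gt_1[of n] by (intro residue_ring_reduction) simp_all
  then interpret group_hom "SL2 (residue_ring (int p ^ Suc n))" "SL2 (residue_ring (int p))"
    "mat2_map (\<lambda>x. x mod int p)"
    using prime_power_gt_1[of 0] prime_power_gt_1[of n] by (intro SL2_hom cring_residue_ring) simp_all
  show ?thesis
    unfolding SL2_congruence_def by (rule subgroup.subgroup_is_group[OF subgroup_kernel]) (rule G.is_group)
qed

lemma mem_SL2_congruence_iff:
  "(a, b, c, d) \<in> carrier (SL2_congruence p n) \<longleftrightarrow>
    {a, b, c, d} \<subseteq> {0..<int p ^ Suc n} \<and> [a * d = 1 + b * c] (mod int p ^ Suc n) \<and>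
    a mod int p = 1 \<and> b mod int p = 0 \<and> c mod int p = 0 \<and> d mod int p = 1"
proof -
  let ?m = "int p ^ Suc n"
  have m: "?m > 1"
    by (rule prime_power_gt_1)
  then interpret residues ?m "residue_ring ?m"
    by (simp add: residues_def)
  have "a \<otimes>\<^bsub>residue_ring ?m\<^esub> d \<ominus>\<^bsub>residue_ring ?m\<^esub> b \<otimes>\<^bsub>residue_ring ?m\<^esub> c = (a * d - b * c) mod ?m"
    by (simp only: a_minus_def res_neg_eq res_mult_eq res_add_eq mod_simps)
      simp
  moreover have "(a * d - b * c) mod ?m = 1 \<longleftrightarrow> [a * d = 1 + b * c] (mod ?m)"
    using m cong_diff_iff_cong_0[of "a * d" "1 + b * c" ?m] cong_diff_iff_cong_0[of "a * d - b * c" 1 ?m]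
    by (simp add: cong_def algebra_simps)
  ultimately show ?thesis
    using m
    by (auto simp: SL2_congruence_def kernel_def mem_SL2_iff one_SL2 residue_ring_def)
qed

text \<open>The entry \<open>a\<close> is 1 modulo \<open>p\<close>, hence a unit, so the
  determinant equation determines \<open>d\<close> from \<open>a\<close>, \<open>b\<close> and
  \<open>c\<close>. Each of these three is free in its class modulo \<open>p\<close>, which has
  \<open>p ^ n\<close> representatives.\<close>

lemma order_SL2_congruence: "order (SL2_congruence p n) = p ^ (3 * n)"
proof -
  let ?m = "int p ^ Suc n"
  define A where "A r = {a \<in> {0..<?m}. a mod int p = r}" for r
  have p1: "int p > 1"
    using p prime_gt_1_nat by simp
  have card_A: "card (A r) = p ^ n" if r: "0 \<le> r" "r < int p" for r
  proof -
    have "A r = (\<lambda>k. r + int p * k) ` {0..<int p ^ n}"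
    proof (intro equalityI subsetI)
      fix a assume a: "a \<in> A r"
      then have "a = r + int p * (a div int p)" "0 \<le> a div int p"
        using p1 by (auto simp: A_def pos_imp_zdiv_nonneg_iff)
      moreover have "a div int p < int p ^ n"
      proof -
        have "a < int p * int p ^ n"
          using a by (simp add: A_def)
        with r \<open>a = r + int p * (a div int p)\<close> have "int p * (a div int p) < int p * int p ^ n"
          by linarith
        then show ?thesis
          using p1 by simp
      qed
      ultimately show "a \<in> (\<lambda>k. r + int p * k) ` {0..<int p ^ n}"
        by auto
    next
      fix a assume "a \<in> (\<lambda>k. r + int p * k) ` {0..<int p ^ n}"
      then obtain k where k: "0 \<le> k" "k < int p ^ n" "a = r + int p * k"
        by auto
      have "int p * (k + 1) \<le> int p * int p ^ n"
        using k p1 by (intro mult_left_mono) auto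
      with k r p1 show "a \<in> A r"
        by (auto simp: A_def algebra_simps)
    qed
    moreover have "inj_on (\<lambda>k. r + int p * k) {0..<int p ^ n}"
      using p1 by (auto simp: inj_on_def)
    ultimately show ?thesis
      by (simp add: card_image nat_power_eq)
  qed
  have "bij_betw (\<lambda>(a, b, c, d). (a, b, c)) (carrier (SL2_congruence p n)) (A 1 \<times> A 0 \<times> A 0)"
    unfolding bij_betw_def
  proof
    have cop: "coprime a ?m" if "a mod int p = 1" for a
    proof -
      have "coprime (a mod int p) (int p)"
        by (simp add: that)
      then show ?thesis
        using p1 by (simp add: coprime_mod_left_iff del: power_Suc)
    qed
    show "inj_on (\<lambda>(a, b, c, d). (a, b, c)) (carrier (SL2_congruence p n))"
    proof (rule inj_onI, clarsimp simp: mem_SL2_congruence_iff simp del: power_Suc)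
      fix a b c d d'
      assume "[a * d = 1 + b * c] (mod ?m)" "[a * d' = 1 + b * c] (mod ?m)"
        and "a mod int p = 1" and d: "0 \<le> d" "d < ?m" "0 \<le> d'" "d' < ?m"
      then have "[d = d'] (mod ?m)"
        using cop cong_mult_lcancel[of a ?m d d'] cong_sym cong_trans by blast
      with d show "d = d'"
        by (simp add: cong_less_imp_eq_int del: power_Suc)
    qed
    show "(\<lambda>(a, b, c, d). (a, b, c)) ` carrier (SL2_congruence p n) = A 1 \<times> A 0 \<times> A 0"
    proof (intro equalityI subsetI)
      fix x assume "x \<in> A 1 \<times> A 0 \<times> A 0"
      then obtain a b c where abc: "x = (a, b, c)" "a \<in> A 1" "b \<in> A 0" "c \<in> A 0"
        by auto
      obtain e where e: "[a * e = 1] (mod ?m)"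
        using abc cop[of a] cong_solve_coprime_int[of a ?m] by (auto simp: A_def)
      \<comment> \<open>The determinant equation solved for \<open>d\<close>, with \<open>e\<close>
        the inverse of \<open>a\<close>.\<close>
      define d where "d = (e * (1 + b * c)) mod ?m"
      have "[a * d = a * (e * (1 + b * c))] (mod ?m)"
        by (simp add: d_def cong_def mod_simps del: power_Suc)
      also have "a * (e * (1 + b * c)) = (a * e) * (1 + b * c)"
        by simp
      also have "[(a * e) * (1 + b * c) = 1 * (1 + b * c)] (mod ?m)"
        by (intro cong_mult cong_refl e)
      finally have ad: "[a * d = 1 + b * c] (mod ?m)"
        by simp
      \<comment> \<open>This entry is automatically 1 modulo \<open>p\<close>: there
        \<open>a\<close> is 1 and \<open>b\<close> is 0, so the determinant equation leaves only
        \<open>d\<close> and 1.\<close>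
      then have "[a * d = 1 + b * c] (mod int p)"
        by (rule cong_dvd_modulus) simp
      moreover have "[a = 1] (mod int p)" "[b = 0] (mod int p)"
        using abc p1 by (auto simp: A_def cong_def)
      ultimately have "[1 * d = 1 + 0 * c] (mod int p)"
        by (meson cong_add cong_mult cong_refl cong_sym cong_trans)
      then have "d mod int p = 1"
        using p1 by (simp add: cong_def)
      moreover have "0 \<le> d" "d < ?m"
        using p1 by (auto simp: d_def simp del: power_Suc)
      ultimately have "(a, b, c, d) \<in> carrier (SL2_congruence p n)"
        using abc ad by (simp add: mem_SL2_congruence_iff A_def)
      then show "x \<in> (\<lambda>(a, b, c, d). (a, b, c)) ` carrier (SL2_congruence p n)"
        using abc by force
    qed (auto simp: mem_SL2_congruence_iff A_def)
  qed
  then have "order (SL2_congruence p n) = card (A 1 \<times> A 0 \<times> A 0)"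
    unfolding order_def by (rule bij_betw_same_card)
  also have "\<dots> = p ^ n * p ^ n * p ^ n"
    using p1 card_A by (simp add: card_cartesian_product)
  finally show ?thesis
    by (simp add: numeral_3_eq_3 power_add)
qed

text \<open>The transition maps between levels. They respect the kernels modulo \<open>p\<close>
  because reducing in two stages agrees with reducing at once.\<close>

lemma group_hom_SL2_congruence_reduction:
  "group_hom (SL2_congruence p (Suc n)) (SL2_congruence p n) (mat2_map (\<lambda>x. x mod int p ^ Suc n))"
proof -
  let ?m = "int p ^ Suc n" and ?m' = "int p ^ Suc (Suc n)"
  have "(\<lambda>x. x mod ?m) \<in> ring_hom (residue_ring ?m') (residue_ring ?m)"
    using prime_power_gt_1[of n] prime_power_gt_1[of "Suc n"]
    by (intro residue_ring_reduction le_imp_power_dvd) simp_all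
  then interpret r: group_hom "SL2 (residue_ring ?m')" "SL2 (residue_ring ?m)" "mat2_map (\<lambda>x. x mod ?m)"
    using prime_power_gt_1[of n] prime_power_gt_1[of "Suc n"] by (intro SL2_hom cring_residue_ring) simp_all
  have mod: "x mod ?m mod int p = x mod int p" for x
    by (simp add: mod_mod_cancel)
  have "mat2_map (\<lambda>x. x mod int p) (mat2_map (\<lambda>x. x mod ?m) x) = mat2_map (\<lambda>x. x mod int p) x" for x
    by (cases x) (simp add: mod del: power_Suc)
  then have "mat2_map (\<lambda>x. x mod ?m) \<in> hom (SL2_congruence p (Suc n)) (SL2_congruence p n)"
    using r.homh
    by (simp add: hom_def SL2_congruence_def kernel_def Pi_iff
        del: power_Suc split_paired_All)
  then show ?thesis
    by (simp add: group_hom_def group_hom_axioms_def group_SL2_congruence)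
qed

end

section \<open>The p-adic congruence subgroup\<close>

lemma mem_padic_ring_iff:
  "x \<in> carrier (padic_ring p) \<longleftrightarrow>
    (\<forall>n. 0 \<le> x n \<and> x n < int p ^ Suc n) \<and> (\<forall>n. x (Suc n) mod int p ^ Suc n = x n)"
  by (auto simp: padic_ring_def residue_ring_def)

lemma padic_ring_apply:
  "(x \<otimes>\<^bsub>padic_ring p\<^esub> y) n = (x n * y n) mod int p ^ Suc n"
  "(x \<oplus>\<^bsub>padic_ring p\<^esub> y) n = (x n + y n) mod int p ^ Suc n"
  "\<one>\<^bsub>padic_ring p\<^esub> n = 1"
  "\<zero>\<^bsub>padic_ring p\<^esub> n = 0"
  by (simp_all add: padic_ring_def residue_ring_def)

text \<open>The matrix form of the inverse limit. Coherence of the sequence is not built in; it is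
  asked for in \<open>mat2_limit_closed\<close>.\<close>

definition mat2_limit :: "(nat \<Rightarrow> int mat2) \<Rightarrow> (nat \<Rightarrow> int) mat2" where
  "mat2_limit Z =
    (\<lambda>n. fst (Z n), \<lambda>n. fst (snd (Z n)), \<lambda>n. fst (snd (snd (Z n))), \<lambda>n. snd (snd (snd (Z n))))"

lemma mat2_map_limit: "mat2_map (\<lambda>x. x n) (mat2_limit Z) = Z n"
  by (simp add: mat2_limit_def)

lemma mat2_eqI: "(\<And>n. mat2_map (\<lambda>x. x n) A = mat2_map (\<lambda>x. x n) B) \<Longrightarrow> A = (B :: (nat \<Rightarrow> int) mat2)"
  by (cases A; cases B) (auto simp: fun_eq_iff)

context
  fixes p :: nat
  assumes p: "prime p"
begin

text \<open>Admits arbitrary integer representatives, so closure under the ring operations becomes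
  compatibility of congruences with sums, products and negation.\<close>

lemma padic_ringI:
  assumes "\<And>n. [f (Suc n) = f n] (mod int p ^ Suc n)"
  shows "(\<lambda>n. f n mod int p ^ Suc n) \<in> carrier (padic_ring p)"
proof -
  have "f (Suc n) mod int p ^ Suc (Suc n) mod int p ^ Suc n = f n mod int p ^ Suc n" for n
    using assms[of n] by (simp add: mod_mod_cancel le_imp_power_dvd cong_def)
  then show ?thesis
    using prime_gt_0_nat[OF p] by (simp add: mem_padic_ring_iff del: power_Suc)
qed

lemma padic_congD:
  "x \<in> carrier (padic_ring p) \<Longrightarrow> [x (Suc n) = x n] (mod int p ^ Suc n)"
  by (metis cong_def mem_padic_ring_iff mod_mod_trivial)

lemma padic_mod_p: "x \<in> carrier (padic_ring p) \<Longrightarrow> x n mod int p = x 0"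
proof (induction n)
  case 0
  then show ?case
    by (auto simp: mem_padic_ring_iff dest!: spec[of _ 0])
next
  case (Suc n)
  have "[x (Suc n) = x n] (mod int p)"
    using padic_congD[OF Suc.prems] by (rule cong_dvd_modulus) simp
  with Suc show ?case
    by (simp add: cong_def)
qed

lemma cring_padic_ring: "cring (padic_ring p)"
proof -
  let ?R = "padic_ring p"
  have add: "x \<oplus>\<^bsub>?R\<^esub> y = (\<lambda>n. (x n + y n) mod int p ^ Suc n)"
    and mult: "x \<otimes>\<^bsub>?R\<^esub> y = (\<lambda>n. (x n * y n) mod int p ^ Suc n)"
    and zero: "\<zero>\<^bsub>?R\<^esub> = (\<lambda>n. 0)" and one: "\<one>\<^bsub>?R\<^esub> = (\<lambda>n. 1)" for x y
    by (auto simp: padic_ring_apply)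
  have mod: "x n mod int p ^ Suc n = x n" if "x \<in> carrier ?R" for x n
    using that by (simp add: mem_padic_ring_iff)
  show ?thesis
  proof (intro cringI abelian_groupI comm_monoidI)
    fix x y assume xy: "x \<in> carrier ?R" "y \<in> carrier ?R"
    show "x \<oplus>\<^bsub>?R\<^esub> y \<in> carrier ?R" "x \<otimes>\<^bsub>?R\<^esub> y \<in> carrier ?R"
      unfolding add mult by (intro padic_ringI cong_add cong_mult padic_congD xy)+
  next
    fix x assume x: "x \<in> carrier ?R"
    show "\<exists>y\<in>carrier ?R. y \<oplus>\<^bsub>?R\<^esub> x = \<zero>\<^bsub>?R\<^esub>"
    proof
      show "(\<lambda>n. (- x n) mod int p ^ Suc n) \<oplus>\<^bsub>?R\<^esub> x = \<zero>\<^bsub>?R\<^esub>"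
        by (auto simp: add zero mod_simps simp del: power_Suc)
      show "(\<lambda>n. (- x n) mod int p ^ Suc n) \<in> carrier ?R"
        using padic_congD[OF x] by (intro padic_ringI) (simp add: cong_minus_minus_iff del: power_Suc)
    qed
    show "\<zero>\<^bsub>?R\<^esub> \<oplus>\<^bsub>?R\<^esub> x = x" "\<one>\<^bsub>?R\<^esub> \<otimes>\<^bsub>?R\<^esub> x = x"
      using mod[OF x] by (auto simp: add mult zero one simp del: power_Suc)
  qed (use prime_power_gt_1[OF p] prime_gt_0_nat[OF p] in
    \<open>auto simp: mem_padic_ring_iff add mult zero one mod_simps algebra_simps simp del: power_Suc\<close>)
qed

section \<open>Passage between the p-adic group and its finite levels\<close>

lemma padic_component_ring_hom:
  "(\<lambda>x. x n) \<in> ring_hom (padic_ring p) (residue_ring (int p ^ Suc n))"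
  by (rule ring_hom_memI) (auto simp: padic_ring_def)

lemma mult_SL2_1_padic: "monoid.mult (SL2_1_padic p) = mat2_mult (padic_ring p)"
  by (simp add: SL2_1_padic_def mult_SL2)

lemma one_SL2_1_padic: "\<one>\<^bsub>SL2_1_padic p\<^esub> = (\<lambda>n. 1, \<lambda>n. 0, \<lambda>n. 0, \<lambda>n. 1)"
  by (simp add: SL2_1_padic_def one_SL2 padic_ring_apply fun_eq_iff)

lemma group_SL2_1_padic: "group (SL2_1_padic p)"
proof -
  have "padic_reduction \<in> ring_hom (padic_ring p) (residue_ring (int p))"
    using padic_component_ring_hom[of 0] by (simp add: padic_reduction_def[abs_def])
  then interpret group_hom "SL2 (padic_ring p)" "SL2 (residue_ring (int p))" "mat2_map padic_reduction"
    using prime_gt_1_nat[OF p] by (intro SL2_hom cring_padic_ring cring_residue_ring) simp_all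
  show ?thesis
    unfolding SL2_1_padic_def by (rule subgroup.subgroup_is_group[OF subgroup_kernel]) (rule G.is_group)
qed

text \<open>The image lies in the kernel modulo \<open>p\<close> because, by
  \<open>padic_mod_p\<close>, every component of a p-adic integer has component 0 as its residue
  modulo \<open>p\<close>, and that is \<open>padic_reduction\<close>.\<close>

lemma mat2_component_hom:
  "group_hom (SL2_1_padic p) (SL2_congruence p n) (mat2_map (\<lambda>x. x n))"
proof -
  let ?m = "int p ^ Suc n"
  interpret c: group_hom "SL2 (padic_ring p)" "SL2 (residue_ring ?m)" "mat2_map (\<lambda>x. x n)"
    using prime_power_gt_1[OF p]
    by (intro SL2_hom cring_padic_ring cring_residue_ring padic_component_ring_hom)
  have "mat2_map (\<lambda>x. x mod int p) (mat2_map (\<lambda>x. x n) A) = mat2_map padic_reduction A"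
    if "A \<in> carrier (SL2 (padic_ring p))" for A
    using that by (cases A) (simp add: mem_SL2_iff padic_reduction_def padic_mod_p)
  then have "mat2_map (\<lambda>x. x n) \<in> hom (SL2_1_padic p) (SL2_congruence p n)"
    using c.homh
    by (simp add: hom_def SL2_congruence_def SL2_1_padic_def kernel_def Pi_iff
        del: power_Suc split_paired_All)
  then show ?thesis
    by (simp add: group_hom_def group_hom_axioms_def group_SL2_congruence group_SL2_1_padic p)
qed

text \<open>An identity of p-adic integers holds once it holds at every level, so the determinant is
  checked there through the component homomorphisms.\<close>

lemma mat2_limit_closed:
  assumes mem: "\<And>n. Z n \<in> carrier (SL2_congruence p n)"
    and compat: "\<And>n. mat2_map (\<lambda>x. x mod int p ^ Suc n) (Z (Suc n)) = Z n"
  shows "mat2_limit Z \<in> carrier (SL2_1_padic p)"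
proof -
  let ?R = "padic_ring p"
  obtain a b c d where abcd: "mat2_limit Z = (a, b, c, d)"
    by (cases "mat2_limit Z")
  then have Z: "Z n = (a n, b n, c n, d n)" for n
    using mat2_map_limit[of n Z] by simp
  have R: "a \<in> carrier ?R" "b \<in> carrier ?R" "c \<in> carrier ?R" "d \<in> carrier ?R"
    using mem compat by (auto simp: Z mem_padic_ring_iff mem_SL2_congruence_iff[OF p])
  interpret R: cring ?R
    by (rule cring_padic_ring)
  have "(a \<otimes>\<^bsub>?R\<^esub> d \<ominus>\<^bsub>?R\<^esub> b \<otimes>\<^bsub>?R\<^esub> c) n = 1" for n
  proof -
    let ?m = "int p ^ Suc n"
    interpret h: ring_hom_cring ?R "residue_ring ?m" "\<lambda>x. x n"
      using prime_power_gt_1[OF p]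
      by (simp add: ring_hom_cring_def ring_hom_cring_axioms_def R.cring_axioms cring_residue_ring
          padic_component_ring_hom del: power_Suc)
    have "(a \<otimes>\<^bsub>?R\<^esub> d \<ominus>\<^bsub>?R\<^esub> b \<otimes>\<^bsub>?R\<^esub> c) n =
        a n \<otimes>\<^bsub>residue_ring ?m\<^esub> d n \<ominus>\<^bsub>residue_ring ?m\<^esub> b n \<otimes>\<^bsub>residue_ring ?m\<^esub> c n"
      using R by (simp only: a_minus_def h.hom_add h.hom_mult h.hom_a_inv R.m_closed R.a_inv_closed)
    also have "\<dots> = 1"
      using mem[of n] by (simp add: Z SL2_congruence_def kernel_def mem_SL2_iff residue_ring_def)
    finally show ?thesis .
  qed
  then have "a \<otimes>\<^bsub>?R\<^esub> d \<ominus>\<^bsub>?R\<^esub> b \<otimes>\<^bsub>?R\<^esub> c = \<one>\<^bsub>?R\<^esub>"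
    by (auto simp: padic_ring_apply)
  \<comment> \<open>At level 0 the entries lie below \<open>p\<close>, so they equal their residues
    modulo \<open>p\<close>; this gives membership in the kernel of the reduction.\<close>
  moreover have "a 0 = 1" "b 0 = 0" "c 0 = 0" "d 0 = 1"
    using mem[of 0] by (auto simp: Z mem_SL2_congruence_iff[OF p] zmod_trivial_iff mod_eq_0_iff_dvd
        dest: zdvd_imp_le)
  ultimately show ?thesis
    using R
    by (simp add: abcd SL2_1_padic_def kernel_def mem_SL2_iff one_SL2 padic_reduction_def
        residue_ring_def)
qed

section \<open>Topology of the p-adic congruence subgroup and extension to the completion\<close>

lemma topspace_SL2_1_padic_topology:
  "topspace (SL2_1_padic_topology p) = carrier (SL2_1_padic p)"
proof -
  have "topspace (padic_topology p) = carrier (padic_ring p)"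
    by (auto simp: padic_topology_def padic_ring_def)
  then show ?thesis
    by (auto simp: SL2_1_padic_topology_def SL2_1_padic_def kernel_def SL2_def)
qed

lemma Hausdorff_SL2_1_padic_topology: "Hausdorff_space (SL2_1_padic_topology p)"
  by (simp add: SL2_1_padic_topology_def padic_topology_def Hausdorff_space_subtopology
      Hausdorff_space_prod_topology Hausdorff_space_product_topology)

text \<open>The target is a subspace of a product of discrete spaces, so continuity is checked for
  each entry at each level, where the map factors through the discrete level group.\<close>

lemma continuous_map_mat2_limit:
  assumes cont: "\<And>n. continuous_map T (discrete_topology (carrier (SL2_congruence p n))) (\<lambda>x. Z x n)"
    and closed: "\<And>x. x \<in> topspace T \<Longrightarrow> mat2_limit (Z x) \<in> carrier (SL2_1_padic p)"
  shows "continuous_map T (SL2_1_padic_topology p) (\<lambda>x. mat2_limit (Z x))"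
proof -
  have padic: "continuous_map T (padic_topology p) (\<lambda>x n. f (Z x n))"
    if mem: "\<And>x. x \<in> topspace T \<Longrightarrow> (\<lambda>n. f (Z x n)) \<in> carrier (padic_ring p)" for f
  proof -
    have "continuous_map T (discrete_topology (carrier (residue_ring (int p ^ Suc n)))) (\<lambda>x. f (Z x n))" for n
    proof -
      \<comment> \<open>Values of \<open>f\<close> are known to be residues only on the matrices
        \<open>Z x n\<close> with \<open>x\<close> in \<open>topspace T\<close>, so continuity is
        first shown into a discrete \<open>UNIV\<close> and then restricted.\<close>
      have "continuous_map T (discrete_topology UNIV) (f \<circ> (\<lambda>x. Z x n))"
        by (rule continuous_map_compose[OF cont]) simp
      moreover have "discrete_topology (carrier (residue_ring (int p ^ Suc n))) =
          subtopology (discrete_topology UNIV) (carrier (residue_ring (int p ^ Suc n)))"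
        by simp
      moreover have "f (Z x n) \<in> carrier (residue_ring (int p ^ Suc n))" if "x \<in> topspace T" for x
        using mem[OF that] by (auto simp: padic_ring_def)
      ultimately show ?thesis
        by (simp add: continuous_map_in_subtopology o_def Pi_iff del: power_Suc subtopology_discrete_topology)
    qed
    then show ?thesis
      using mem by (auto simp: padic_topology_def continuous_map_in_subtopology continuous_map_componentwise_UNIV)
  qed
  have "mat2_limit (Z x) \<in> carrier (padic_ring p) \<times> carrier (padic_ring p) \<times>
      carrier (padic_ring p) \<times> carrier (padic_ring p)"
    if "x \<in> topspace T" for x
    using closed[OF that] by (auto simp: SL2_1_padic_def kernel_def SL2_def)
  then show ?thesis
    unfolding SL2_1_padic_topology_def continuous_map_in_subtopology mat2_limit_def
    using closed by (auto simp: continuous_map_pairwise o_def mat2_limit_def intro!: padic)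
qed

text \<open>Each reduction of \<open>\<phi>\<close> has a target whose order is a power of
  \<open>p\<close>, hence a kernel of p-power index, and lifts to the completion. The lifts are
  coherent across levels and glue to \<open>\<rho>\<close>.\<close>

lemma SL2_1_padic_extend:
  assumes F: "group F" and \<phi>: "\<phi> \<in> hom F (SL2_1_padic p)"
  obtains \<rho> where "\<rho> \<in> hom (pro_p_completion p F) (SL2_1_padic p)"
    and "continuous_map (pro_p_completion_topology p F) (SL2_1_padic_topology p) \<rho>"
    and "\<And>g. g \<in> carrier F \<Longrightarrow> \<rho> (pro_p_completion_map p F g) = \<phi> g"
proof -
  define h where "h n = mat2_map (\<lambda>x. x n) \<circ> \<phi>" for n
  let ?H = "SL2_congruence p"
  have h: "group_hom F (?H n) (h n)" for n
    using F hom_compose[OF \<phi> group_hom.homh[OF mat2_component_hom]]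
    by (simp add: group_hom_def group_hom_axioms_def h_def group_SL2_congruence p)
  have N: "kernel F (?H n) (h n) \<in> p_power_index_normals p F" for n
    by (rule group_hom.kernel_in_p_power_index_normals[OF h p order_SL2_congruence[OF p]])
  define \<psi> where "\<psi> n = pro_p_lift F (?H n) (h n)" for n
  have \<psi>: "\<psi> n \<in> hom (pro_p_completion p F) (?H n)" for n
    unfolding \<psi>_def by (rule group_hom.pro_p_lift_hom[OF h N])
  have compat: "mat2_map (\<lambda>x. x mod int p ^ Suc n) (\<psi> (Suc n) x) = \<psi> n x"
    if "x \<in> carrier (pro_p_completion p F)" for n x
    unfolding \<psi>_def
  \<comment> \<open>Coherence of the lifts reduces to coherence of the reductions of
    \<open>\<phi>\<close> on \<open>F\<close>.\<close>
  proof (rule pro_p_lift_compat[OF h h N N group_hom_SL2_congruence_reduction[OF p] _ that])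
    fix g assume "g \<in> carrier F"
    then have "\<phi> g \<in> carrier (SL2_1_padic p)"
      using \<phi> by (auto simp: hom_def)
    then show "mat2_map (\<lambda>x. x mod int p ^ Suc n) (h (Suc n) g) = h n g"
      by (cases "\<phi> g") (simp add: h_def SL2_1_padic_def kernel_def mem_SL2_iff mem_padic_ring_iff del: power_Suc)
  qed
  define \<rho> where "\<rho> x = mat2_limit (\<lambda>n. \<psi> n x)" for x
  have \<rho>_n: "mat2_map (\<lambda>y. y n) (\<rho> x) = \<psi> n x" for n x
    by (simp add: \<rho>_def mat2_map_limit)
  have closed: "\<rho> x \<in> carrier (SL2_1_padic p)" if "x \<in> carrier (pro_p_completion p F)" for x
    unfolding \<rho>_def using \<psi> compat that by (intro mat2_limit_closed) (auto simp: hom_def)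
  show ?thesis
  proof
    show "\<rho> \<in> hom (pro_p_completion p F) (SL2_1_padic p)"
    proof (rule homI)
      fix x y assume xy: "x \<in> carrier (pro_p_completion p F)" "y \<in> carrier (pro_p_completion p F)"
      show "\<rho> (x \<otimes>\<^bsub>pro_p_completion p F\<^esub> y) = \<rho> x \<otimes>\<^bsub>SL2_1_padic p\<^esub> \<rho> y"
      proof (rule mat2_eqI)
        fix n
        interpret c: group_hom "SL2_1_padic p" "?H n" "mat2_map (\<lambda>x. x n)"
          by (rule mat2_component_hom)
        show "mat2_map (\<lambda>x. x n) (\<rho> (x \<otimes>\<^bsub>pro_p_completion p F\<^esub> y)) =
            mat2_map (\<lambda>x. x n) (\<rho> x \<otimes>\<^bsub>SL2_1_padic p\<^esub> \<rho> y)"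
          using xy closed hom_mult[OF \<psi>] by (simp add: \<rho>_n)
      qed
    qed (rule closed)
    have top: "topspace (pro_p_completion_topology p F) \<subseteq> carrier (pro_p_completion p F)"
      by (simp add: pro_p_completion_topology_def)
    show "continuous_map (pro_p_completion_topology p F) (SL2_1_padic_topology p) \<rho>"
      unfolding \<rho>_def[abs_def]
    proof (rule continuous_map_mat2_limit)
      show "continuous_map (pro_p_completion_topology p F) (discrete_topology (carrier (?H n))) (\<psi> n)" for n
        unfolding \<psi>_def by (rule group_hom.continuous_map_pro_p_lift[OF h N])
    qed (use closed top in \<open>auto simp: \<rho>_def\<close>)
    show "\<rho> (pro_p_completion_map p F g) = \<phi> g" if "g \<in> carrier F" for g
      using group_hom.pro_p_lift_map[OF h N that]
      by (intro mat2_eqI) (simp add: \<rho>_n \<psi>_def h_def)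
  qed
qed

end

section \<open>A square root of q\<close>

text \<open>Induction through \<open>y ^ p - 1 = (y - 1) * (\<Sum>i<p. y ^ i)\<close>: the first
  factor supplies \<open>p ^ Suc n\<close>, and the sum, having \<open>p\<close> terms congruent to
  1, supplies one more \<open>p\<close>.\<close>

lemma cong_1_power_prime_power:
  fixes x :: int
  assumes "[x = 1] (mod int p)"
  shows "[x ^ (p ^ n) = 1] (mod int p ^ Suc n)"
proof (induction n)
  case 0
  then show ?case
    using assms by simp
next
  case (Suc n)
  define y where "y = x ^ (p ^ n)"
  have "[y = 1] (mod int p)"
    using Suc unfolding y_def by (rule cong_dvd_modulus) simp
  then have "[(\<Sum>i<p. y ^ i) = (\<Sum>i<p. 1 ^ i)] (mod int p)"
    by (intro cong_sum cong_pow)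
  then have "int p dvd (\<Sum>i<p. y ^ i)"
    by (simp add: cong_dvd_iff)
  moreover have "int p ^ Suc n dvd y - 1"
    using Suc by (simp add: y_def cong_iff_dvd_diff)
  ultimately have "int p ^ Suc n * int p dvd (y - 1) * (\<Sum>i<p. y ^ i)"
    by (rule mult_dvd_mono[rotated])
  then have "int p ^ Suc (Suc n) dvd y ^ p - 1"
    by (simp add: power_diff_1_eq mult.commute)
  then show ?case
    by (simp add: y_def cong_iff_dvd_diff mult.commute flip: power_mult)
qed

text \<open>Compares the exponents in the square root of \<open>q\<close> at consecutive levels:
  they differ by a multiple of \<open>p ^ n\<close>, to which
  \<open>cong_1_power_prime_power\<close> applies.\<close>

lemma odd_power_half_Suc:
  assumes "odd (p :: nat)"
  shows "p ^ Suc n div 2 = p ^ n div 2 + p ^ n * (p div 2)"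
proof -
  obtain j k where jk: "p ^ n = 2 * j + 1" "p = 2 * k + 1"
    using assms by (metis oddE even_power)
  have "p ^ Suc n = (2 * k + 1) * (2 * j + 1)"
    using jk by simp
  also have "\<dots> = 2 * (j + (2 * j + 1) * k) + 1"
    by (simp add: algebra_simps)
  finally have "p ^ Suc n div 2 = j + (2 * j + 1) * k"
    by simp
  then show ?thesis
    using jk by simp
qed

text \<open>
  Since \<open>q\<^bsup>p^n\<^esup> \<equiv> 1\<close> modulo \<open>p\<^bsup>n+1\<^esup>\<close>, the square root of \<open>q\<close> is \<open>q\<^bsup>(p^n+1)/2\<^esup>\<close> at level \<open>n\<close>,
  with inverse \<open>q\<^bsup>(p^n-1)/2\<^esup>\<close>.
\<close>

definition sigma_matrix :: "nat \<Rightarrow> nat \<Rightarrow> (nat \<Rightarrow> int) mat2" where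
  "sigma_matrix p q =
    (\<lambda>n. int q ^ Suc (p ^ n div 2) mod int p ^ Suc n, \<lambda>n. 0, \<lambda>n. 0,
     \<lambda>n. int q ^ (p ^ n div 2) mod int p ^ Suc n)"

text \<open>The entry \<open>p\<close> in place of 1 makes the matrix trivial modulo
  \<open>p\<close>; its component at level 0 is therefore 0.\<close>

definition tau_matrix :: "nat \<Rightarrow> (nat \<Rightarrow> int) mat2" where
  "tau_matrix p = (\<lambda>n. 1, \<lambda>n. int p mod int p ^ Suc n, \<lambda>n. 0, \<lambda>n. 1)"

lemma sigma_matrix_closed:
  assumes p: "prime p" "odd p" and q: "[q = 1] (mod p)"
  shows "sigma_matrix p q \<in> carrier (SL2_1_padic p)"
proof -
  define Z where "Z n = (int q ^ Suc (p ^ n div 2) mod int p ^ Suc n, 0 :: int, 0 :: int,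
    int q ^ (p ^ n div 2) mod int p ^ Suc n)" for n
  have q1: "[int q = 1] (mod int p)"
    using q by (metis cong_int_iff of_nat_1)
  have p1: "int p > 1"
    using p prime_gt_1_nat by simp
  have "mat2_limit Z \<in> carrier (SL2_1_padic p)"
  proof (rule mat2_limit_closed[OF p(1)])
    fix n
    let ?m = "int p ^ Suc n"
    have m: "?m > 1"
      using prime_power_gt_1[OF p(1)] .
    have modp: "int q ^ k mod ?m mod int p = 1" for k
      using cong_pow[OF q1, of k] p1 by (simp add: mod_mod_cancel cong_def)
    \<comment> \<open>For odd \<open>p\<close> the two exponents add up to \<open>p ^ n\<close>, so
      the product of the diagonal entries is \<open>q ^ (p ^ n)\<close>, which is 1 at this
      level.\<close>
    have "Suc (p ^ n div 2) + p ^ n div 2 = p ^ n"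
      using p(2) by (metis add_Suc even_power mult_2 odd_two_times_div_two_succ Suc_eq_plus1)
    then have "int q ^ Suc (p ^ n div 2) * int q ^ (p ^ n div 2) = int q ^ (p ^ n)"
      by (metis power_add)
    then have "[int q ^ Suc (p ^ n div 2) mod ?m * (int q ^ (p ^ n div 2) mod ?m) = 1] (mod ?m)"
      using cong_1_power_prime_power[OF q1, of n] by (simp add: cong_def mod_simps del: power_Suc)
    then show "Z n \<in> carrier (SL2_congruence p n)"
      using m p1 by (simp add: Z_def mem_SL2_congruence_iff[OF p(1)] modp del: power_Suc)
    \<comment> \<open>Going up one level multiplies the power of \<open>q\<close> by a power of
      \<open>q ^ (p ^ n)\<close>, which is 1 for the lower modulus.\<close>
    have "[int q ^ (p ^ Suc n div 2) = int q ^ (p ^ n div 2) * 1 ^ (p div 2)] (mod ?m)"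
      unfolding odd_power_half_Suc[OF p(2)] power_add power_mult
      by (intro cong_mult cong_pow cong_refl cong_1_power_prime_power[OF q1])
    then have half: "[int q ^ (p ^ Suc n div 2) = int q ^ (p ^ n div 2)] (mod ?m)"
      by simp
    then have "[int q ^ Suc (p ^ Suc n div 2) = int q ^ Suc (p ^ n div 2)] (mod ?m)"
      by (simp add: cong_mult cong_refl del: power_Suc add: power_Suc[of "int q"])
    with half show "mat2_map (\<lambda>x. x mod ?m) (Z (Suc n)) = Z n"
      by (simp add: Z_def mod_mod_cancel le_imp_power_dvd cong_def del: power_Suc)
  qed
  then show ?thesis
    by (simp add: Z_def[abs_def] mat2_limit_def sigma_matrix_def)
qed

section \<open>The unipotent matrix and the defining relation\<close>

lemma tau_matrix_closed:
  assumes p: "prime p"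
  shows "tau_matrix p \<in> carrier (SL2_1_padic p)"
proof -
  define Z where "Z n = (1 :: int, int p mod int p ^ Suc n, 0 :: int, 1 :: int)" for n
  have "mat2_limit Z \<in> carrier (SL2_1_padic p)"
  proof (rule mat2_limit_closed[OF p])
    fix n
    show "Z n \<in> carrier (SL2_congruence p n)"
      using prime_power_gt_1[OF p, of n] prime_gt_1_nat[OF p]
      by (simp add: Z_def mem_SL2_congruence_iff[OF p] mod_mod_cancel)
    show "mat2_map (\<lambda>x. x mod int p ^ Suc n) (Z (Suc n)) = Z n"
      using prime_power_gt_1[OF p, of n]
      by (simp add: Z_def mod_mod_cancel le_imp_power_dvd del: power_Suc)
  qed
  then show ?thesis
    by (simp add: Z_def[abs_def] mat2_limit_def tau_matrix_def)
qed

lemma tau_matrix_power: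
  assumes p: "prime p"
  shows "tau_matrix p [^]\<^bsub>SL2_1_padic p\<^esub> (k :: nat) =
    (\<lambda>n. 1, \<lambda>n. int (k * p) mod int p ^ Suc n, \<lambda>n. 0, \<lambda>n. 1)"
proof -
  interpret group "SL2_1_padic p"
    by (rule group_SL2_1_padic[OF p])
  show ?thesis
  proof (induction k)
    case 0
    then show ?case
      by (simp add: one_SL2_1_padic[OF p])
  next
    case (Suc k)
    have "1 mod int p ^ Suc n = 1" for n
      using prime_power_gt_1[OF p, of n] by simp
    with Suc show ?case
      by (simp add: tau_matrix_def mult_SL2_1_padic[OF p] fun_eq_iff padic_ring_apply mod_simps
          algebra_simps del: power_Suc)
  qed
qed

text \<open>The upper left entry of \<open>sigma_matrix\<close> is \<open>q\<close> times the lower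
  right one, so the upper right entries of both products agree. The form without inverses allows an
  entrywise check.\<close>

lemma sigma_tau_relation:
  assumes p: "prime p"
  shows "sigma_matrix p q \<otimes>\<^bsub>SL2_1_padic p\<^esub> tau_matrix p =
    tau_matrix p [^]\<^bsub>SL2_1_padic p\<^esub> q \<otimes>\<^bsub>SL2_1_padic p\<^esub> sigma_matrix p q"
  unfolding tau_matrix_power[OF p] mult_SL2_1_padic[OF p]
  by (simp add: sigma_matrix_def tau_matrix_def fun_eq_iff padic_ring_apply mod_simps
      power_Suc[of "int q"] del: power_Suc)
    (simp add: algebra_simps)

text \<open>Level \<open>k\<close> detects the power: the upper right entry \<open>k * p\<close>
  vanishes there only if \<open>p ^ k\<close> divides \<open>k\<close>, which is impossible since
  \<open>0 < k < p ^ k\<close>.\<close>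

lemma tau_matrix_infinite_order:
  assumes p: "prime p" and k: "k > 0"
  shows "tau_matrix p [^]\<^bsub>SL2_1_padic p\<^esub> (k :: nat) \<noteq> \<one>\<^bsub>SL2_1_padic p\<^esub>"
proof
  assume "tau_matrix p [^]\<^bsub>SL2_1_padic p\<^esub> k = \<one>\<^bsub>SL2_1_padic p\<^esub>"
  then have "int (k * p) mod int p ^ Suc k = 0"
    by (simp add: tau_matrix_power[OF p] one_SL2_1_padic[OF p] fun_eq_iff del: power_Suc)
  then have "p ^ Suc k dvd k * p"
    by (metis mod_0_imp_dvd of_nat_dvd_iff of_nat_power)
  then have "p ^ k dvd k"
    using prime_gt_0_nat[OF p] by simp
  then have "p ^ k \<le> k"
    using k by (simp add: dvd_imp_le)
  moreover have "k < p ^ k"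
    using prime_gt_1_nat[OF p] by (simp add: power_gt_expt)
  ultimately show False
    by simp
qed

section \<open>The homomorphism on G\<close>

theorem theorem7p16:
  fixes p q :: nat
  assumes "prime p" and "odd p" and "prime q" and "[q = 1] (mod p)"
  shows "\<exists>\<rho>. \<rho> \<in> hom (G_group p q) (SL2_1_padic p) \<and>
             continuous_map (G_topology p q) (SL2_1_padic_topology p) \<rho> \<and>
             (\<forall>n::nat. n > 0 \<longrightarrow>
                \<rho> (G_gen p q gen_tau) [^]\<^bsub>SL2_1_padic p\<^esub> n \<noteq> \<one>\<^bsub>SL2_1_padic p\<^esub>)"
proof -
  let ?\<Gamma> = "SL2_1_padic p" and ?C = "free_pro_p p" and ?T = "free_pro_p_topology p"
  note p = \<open>prime p\<close>
  interpret \<Gamma>: group ?\<Gamma>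
    by (rule group_SL2_1_padic[OF p])
  interpret C: group ?C
    by (rule group_pro_p_completion[OF group_free_group])
  define f where "f a = (case a of gen_sigma \<Rightarrow> sigma_matrix p q | gen_tau \<Rightarrow> tau_matrix p)" for a
  note S = sigma_matrix_closed[OF assms(1,2,4)] and T = tau_matrix_closed[OF p]
  have "f a \<in> carrier ?\<Gamma>" for a
    using S T by (simp add: f_def split: generator.split)
  then obtain \<phi> where \<phi>: "\<phi> \<in> hom free_group ?\<Gamma>" "\<And>a. \<phi> (free_gen a) = f a"
    using \<Gamma>.free_group_lift[of f] by blast
  obtain \<rho> where \<rho>: "\<rho> \<in> hom ?C ?\<Gamma>" "continuous_map ?T (SL2_1_padic_topology p) \<rho>"
    "\<And>g. g \<in> carrier free_group \<Longrightarrow> \<rho> (pro_p_completion_map p free_group g) = \<phi> g"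
    using SL2_1_padic_extend[OF p group_free_group \<phi>(1)] by blast
  interpret \<rho>: group_hom ?C ?\<Gamma> \<rho>
    by (simp add: group_hom_def group_hom_axioms_def C.is_group \<Gamma>.is_group \<rho>(1))
  have gen_closed: "free_pro_p_gen p a \<in> carrier ?C" for a
    unfolding free_pro_p_gen_def
    by (rule pro_p_completion_map_closed) (simp add: free_gen_def carrier_free_group)
  have \<rho>_gen: "\<rho> (free_pro_p_gen p a) = f a" for a
    using \<rho>(3) \<phi>(2) by (simp add: free_pro_p_gen_def free_gen_def carrier_free_group)
  have topC: "topspace ?T = carrier ?C"
    by (auto simp: pro_p_completion_topology_def pro_p_completion_def)
  let ?K = "kernel ?C ?\<Gamma> \<rho>"
  have "\<rho> (relator p q) = sigma_matrix p q \<otimes>\<^bsub>?\<Gamma>\<^esub> tau_matrix p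
      \<otimes>\<^bsub>?\<Gamma>\<^esub> inv\<^bsub>?\<Gamma>\<^esub> sigma_matrix p q \<otimes>\<^bsub>?\<Gamma>\<^esub> tau_matrix p [^]\<^bsub>?\<Gamma>\<^esub> (- int q)"
    by (simp add: relator_def gen_closed \<rho>_gen \<rho>.hom_int_pow f_def)
  \<comment> \<open>After \<open>sigma_tau_relation\<close> the product starts with the q-th power
    of the image of \<tau>; the image of \<sigma> then meets its inverse and the rest
    cancels.\<close>
  also have "\<dots> = \<one>\<^bsub>?\<Gamma>\<^esub>"
    unfolding sigma_tau_relation[OF p] using S T
    by (simp add: \<Gamma>.m_assoc \<Gamma>.int_pow_neg_int)
  finally have "relator p q \<in> ?K"
    by (simp add: kernel_def relator_def gen_closed)
  moreover have "closedin ?T ?K"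
  proof -
    \<comment> \<open>The kernel is the preimage of a point, which is closed because the target is
      Hausdorff.\<close>
    have "closedin (SL2_1_padic_topology p) {\<one>\<^bsub>?\<Gamma>\<^esub>}"
      by (rule closedin_Hausdorff_singleton[OF Hausdorff_SL2_1_padic_topology[OF p]])
        (simp add: topspace_SL2_1_padic_topology[OF p])
    then show ?thesis
      using closedin_continuous_map_preimage[OF \<rho>(2), of "{\<one>\<^bsub>?\<Gamma>\<^esub>}"] by (simp add: kernel_def topC)
  qed
  \<comment> \<open>The kernel belongs to the family whose intersection is
    \<open>relation_subgroup\<close>. So the family is nonempty, as \<open>normal_Inter\<close>
    requires, and the intersection lies in the kernel.\<close>
  ultimately have K: "?K \<in> {N. N \<lhd> ?C \<and> closedin ?T N \<and> {relator p q} \<subseteq> N}"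
    using \<rho>.normal_kernel by simp
  have "relation_subgroup p q \<lhd> ?C"
    unfolding relation_subgroup_def closed_normal_closure_def
    by (rule C.normal_Inter) (use K in blast)+
  moreover have "relation_subgroup p q \<subseteq> ?K"
    unfolding relation_subgroup_def closed_normal_closure_def using K by (rule Inter_lower)
  ultimately obtain r where r: "r \<in> hom (G_group p q) ?\<Gamma>"
    "continuous_map (G_topology p q) (SL2_1_padic_topology p) r"
    "\<And>x. x \<in> carrier ?C \<Longrightarrow> r (relation_subgroup p q #>\<^bsub>?C\<^esub> x) = \<rho> x"
    unfolding G_group_def G_topology_def
    using \<rho>.FactGroup_topology_universal[OF \<rho>(2) topC] by blast
  have "r (G_gen p q gen_tau) = tau_matrix p"
    by (simp add: G_gen_def r(3) gen_closed \<rho>_gen f_def)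
  with r(1,2) tau_matrix_infinite_order[OF p] show ?thesis
    by auto
qed

end
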